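(* Let $w$ be a prime and let $n>w$ be an integer with $\gcd(n,w)\neq 1$. Then there is no cyclic optimal constant-weight Gray code of weight $w$ for $(1,2,n)$-LRM.
   Context: Write a binary string of length $n$ as $v=v_0v_1\cdots v_{n-1}$ with indices taken modulo $n$. Let $S(n,w)$ be the set of binary strings of length $n$ with exactly $w$ ones (weight $w$); strings used in codes are never all-zeros or all-ones, so $1\le w\le n-1$. For $0\le j\le n-1$, the string $v'=\tau_j(v)$ is given by $v'_j=0$, $v'_{j+1}=1$ (index mod $n$), and $v'_k=v_k$ for all other $k$. A constant-weight Gray code of weight $w$ and size $N$ for $(1,2,n)$-LRM ("local rank modulation") is a sequence $G=g_0,\dots,g_{N-1}$ of distinct strings in $S(n,w)$ such that for every $0\le i\le N-2$ there is a $j$ with $g_{i+1}=\tau_j(g_i)$. It is cyclic if in addition $g_0=\tau_j(g_{N-1})$ for some $j$. It is optimal if $N=\binom{n}{w}$. *)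

theory Defs
  imports "HOL-Computational_Algebra.Primes"
begin

text \<open>A binary string is a list of bits, with \<open>True\<close> for 1 and \<open>False\<close> for 0.\<close>

definition weight :: "bool list \<Rightarrow> nat" where
  "weight v = count_list v True"

definition const_weight_strings :: "nat \<Rightarrow> nat \<Rightarrow> bool list set" where
  "const_weight_strings n w = {v. length v = n \<and> weight v = w}"

text \<open>\<open>tau\<close> is deliberately not guarded by a condition on the bits at positions \<open>j\<close> and
  \<open>j + 1\<close>. In a code, distinctness and constant weight force them to be 1 and 0.\<close>

definition tau :: "nat \<Rightarrow> bool list \<Rightarrow> bool list" where
  "tau j v = v[j := False, (j + 1) mod length v := True]"

definition gray_code :: "nat \<Rightarrow> nat \<Rightarrow> bool list list \<Rightarrow> bool" where
  "gray_code n w G \<longleftrightarrow>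
     1 \<le> w \<and> w < n \<and> G \<noteq> [] \<and> distinct G \<and> set G \<subseteq> const_weight_strings n w \<and>
     (\<forall>i. i + 1 < length G \<longrightarrow> (\<exists>j<n. G ! (i + 1) = tau j (G ! i)))"

definition cyclic_gray_code :: "nat \<Rightarrow> nat \<Rightarrow> bool list list \<Rightarrow> bool" where
  "cyclic_gray_code n w G \<longleftrightarrow>
     gray_code n w G \<and> (\<exists>j<n. G ! 0 = tau j (G ! (length G - 1)))"

definition optimal_gray_code :: "nat \<Rightarrow> nat \<Rightarrow> bool list list \<Rightarrow> bool" where
  "optimal_gray_code n w G \<longleftrightarrow> gray_code n w G \<and> length G = n choose w"

end

theory Submission
  imports Defs "HOL-Number_Theory.Cong"
begin

text \<open>Every move shifts a single 1 one place to the right, so it increases the sum of the positions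
  of the ones by 1 modulo \<open>n\<close>. Hence the length \<open>n choose w\<close> of a closed optimal code is a multiple
  of \<open>n\<close>. Since \<open>w * (n choose w) = n * ((n - 1) choose (w - 1))\<close>, the prime \<open>w\<close> then divides
  \<open>(n - 1) choose (w - 1)\<close>, which is impossible when \<open>w\<close> divides \<open>n\<close>.\<close>

text \<open>The parameter \<open>f\<close> lets one update computation serve both the weight
  (\<open>f\<close> constantly 1) and the position sum (\<open>f = id\<close>).\<close>

definition ones_sum :: "(nat \<Rightarrow> nat) \<Rightarrow> bool list \<Rightarrow> nat" where
  "ones_sum f v = (\<Sum>i<length v. if v ! i then f i else 0)"

lemma weight_eq_ones_sum: "weight v = ones_sum (\<lambda>_. 1) v"
  by (induction v)
    (simp_all add: weight_def ones_sum_def sum.lessThan_Suc_shift del: sum.lessThan_Suc)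

lemma ones_sum_update:
  assumes "j < length v"
  shows "ones_sum f (v[j := b]) + (if v ! j then f j else 0) =
    ones_sum f v + (if b then f j else 0)"
proof -
  have eq: "ones_sum f u = (if u ! j then f j else 0) +
      (\<Sum>i\<in>{..<length u} - {j}. if u ! i then f i else 0)" if "j < length u" for u
    unfolding ones_sum_def using that by (subst sum.remove[of _ j]) auto
  have "(\<Sum>i\<in>{..<length v} - {j}. if v[j := b] ! i then f i else 0) =
      (\<Sum>i\<in>{..<length v} - {j}. if v ! i then f i else 0)"
    by (intro sum.cong) auto
  then show ?thesis
    using eq[of v] eq[of "v[j := b]"] assms by simp
qed

lemma length_tau [simp]: "length (tau j v) = length v"
  by (simp add: tau_def)

text \<open>Since \<open>tau\<close> is unguarded, the two last hypotheses are what makes it a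
  genuine shift: they force a 1 at \<open>j\<close> and a 0 at its cyclic successor.
  \<open>n \<ge> 2\<close> keeps these two positions distinct.\<close>

lemma tau_cong_ones_sum:
  assumes n: "length v = n" "n \<ge> 2" and j: "j < n"
    and weight: "weight (tau j v) = weight v" and neq: "tau j v \<noteq> v"
  shows "[ones_sum id (tau j v) = ones_sum id v + 1] (mod n)"
proof -
  define k where "k = (j + 1) mod n"
  have k: "k < n" "k \<noteq> j" "[k = j + 1] (mod n)"
    using n j by (auto simp: k_def mod_Suc cong_def)
  have tau: "tau j v = v[j := False, k := True]"
    by (simp add: tau_def k_def n)
  have sums: "ones_sum f (tau j v) + (if v ! k then f k else 0) + (if v ! j then f j else 0) =
      ones_sum f v + f k" for f
    using ones_sum_update[of j v f False] ones_sum_update[of k "v[j := False]" f True] k j n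
    by (simp add: tau)
  \<comment> \<open>In this case both updates would write bits that are already there. Two equal
    bits are then excluded by the weight, which would change by one.\<close>
  have "\<not> (v ! k \<and> \<not> v ! j)"
    using neq k by (metis tau list_update_id)
  then have "v ! j" "\<not> v ! k"
    using sums[of "\<lambda>_. 1"] weight by (auto simp: weight_eq_ones_sum split: if_splits)
  then have "ones_sum id (tau j v) + j = ones_sum id v + k"
    using sums[of id] by simp
  \<comment> \<open>The congruence absorbs the wrap-around \<open>j = n - 1\<close>,
    \<open>k = 0\<close>.\<close>
  then have "[ones_sum id (tau j v) + j = ones_sum id v + 1 + j] (mod n)"
    using cong_add[OF cong_refl[of "ones_sum id v"] k(3)] by (simp add: ac_simps)
  then show ?thesis
    by (simp only: cong_add_rcancel_nat)
qed

text \<open>Going once around the cycle adds \<open>length G\<close> to the position sum and returns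
  to the same string. With a single string, the closing move could leave it fixed and add
  nothing.\<close>

lemma dvd_length_cyclic_gray_code:
  assumes "cyclic_gray_code n w G" and "length G \<ge> 2"
  shows "n dvd length G"
proof -
  define N where "N = length G"
  have gray: "1 \<le> w" "w < n" "distinct G" "set G \<subseteq> const_weight_strings n w"
    "\<And>i. i + 1 < N \<Longrightarrow> \<exists>j<n. G ! (i + 1) = tau j (G ! i)"
    and closing: "\<exists>j<n. G ! 0 = tau j (G ! (N - 1))"
    using assms(1) by (auto simp: cyclic_gray_code_def gray_code_def N_def)
  \<comment> \<open>Arbitrary distinct indices cover both consecutive strings and the closing
    pair.\<close>
  have step: "[ones_sum id (G ! b) = ones_sum id (G ! a) + 1] (mod n)"
    if ab: "a < N" "b < N" "a \<noteq> b" and move: "\<exists>j<n. G ! b = tau j (G ! a)" for a b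
  proof -
    obtain j where j: "j < n" "G ! b = tau j (G ! a)"
      using move by blast
    have "G ! a \<in> const_weight_strings n w" "G ! b \<in> const_weight_strings n w"
      using ab gray(4) by (auto simp: N_def)
    moreover have "G ! b \<noteq> G ! a"
      using ab gray(3) by (simp add: N_def nth_eq_iff_index_eq)
    ultimately show ?thesis
      using tau_cong_ones_sum[of "G ! a" n j] j gray(1,2) by (auto simp: const_weight_strings_def)
  qed
  have along: "[ones_sum id (G ! i) = ones_sum id (G ! 0) + i] (mod n)" if "i < N" for i
    using that
  proof (induction i)
    case (Suc i)
    then have "[ones_sum id (G ! Suc i) = ones_sum id (G ! i) + 1] (mod n)"
      using step[of i "Suc i"] gray(5)[of i] by simp
    also have "[ones_sum id (G ! i) + 1 = ones_sum id (G ! 0) + i + 1] (mod n)"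
      using Suc.prems by (intro cong_add cong_refl Suc.IH) simp
    finally show ?case by (simp only: add.assoc Suc_eq_plus1)
  qed simp
  have "[ones_sum id (G ! 0) = ones_sum id (G ! (N - 1)) + 1] (mod n)"
    using assms(2) by (intro step[OF _ _ _ closing]) (auto simp: N_def)
  also have "[ones_sum id (G ! (N - 1)) + 1 = ones_sum id (G ! 0) + (N - 1) + 1] (mod n)"
    using along[of "N - 1"] assms(2) by (intro cong_add cong_refl) (simp add: N_def)
  also have "ones_sum id (G ! 0) + (N - 1) + 1 = ones_sum id (G ! 0) + N"
    using assms(2) by (simp add: N_def)
  finally have "[N = 0] (mod n)"
    by (metis cong_add_lcancel_0_nat cong_sym)
  then show ?thesis
    by (simp add: cong_0_iff N_def)
qed

text \<open>Modulo \<open>p\<close> the binomial is (-1)^k. The induction passes from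
  \<open>k\<close> to \<open>k + 1\<close> through the factors \<open>n - 1 - k\<close> and
  \<open>k + 1\<close>.\<close>

lemma prime_not_dvd_pred_choose:
  fixes p n k :: nat
  assumes "prime p" "p dvd n" "n > 0" "k < p"
  shows "\<not> p dvd ((n - 1) choose k)"
  using \<open>k < p\<close>
proof (induction k)
  case 0
  then show ?case using prime_gt_Suc_0_nat[OF \<open>prime p\<close>] by simp
next
  case (Suc k)
  have "Suc k < n"
    using Suc.prems dvd_imp_le[OF assms(2,3)] by simp
  \<comment> \<open>As \<open>p\<close> divides \<open>n\<close>, it would otherwise divide
    \<open>k + 1\<close>, which is positive and less than \<open>p\<close>.\<close>
  then have "\<not> p dvd n - 1 - k"
    using Suc.prems \<open>p dvd n\<close> by (auto dest!: dvd_diffD1 nat_dvd_not_less)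
  then have "\<not> p dvd ((n - 1) choose k) * (n - 1 - k)"
    using Suc \<open>prime p\<close> by (simp add: prime_dvd_mult_iff)
  moreover have "((n - 1) choose k) * (n - 1 - k) = ((n - 1) choose Suc k) * Suc k"
    using binomial_absorb_comp[of "n - 1" k] binomial_absorption[of k "n - 1"]
    by (simp add: mult.commute)
  ultimately show ?case by auto
qed

theorem theorem5:
  fixes n w :: nat
  assumes "prime w" and "n > w" and "gcd n w \<noteq> 1"
  shows "\<not> (\<exists>G. cyclic_gray_code n w G \<and> optimal_gray_code n w G)"
proof
  assume "\<exists>G. cyclic_gray_code n w G \<and> optimal_gray_code n w G"
  then obtain G where G: "cyclic_gray_code n w G" "length G = n choose w"
    by (auto simp: optimal_gray_code_def)
  have w: "w \<ge> 2" "w dvd n"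
    using assms prime_ge_2_nat prime_imp_coprime[of w n]
    by (auto simp: coprime_iff_gcd_eq_1 gcd.commute)
  have absorb: "w * (n choose w) = n * ((n - 1) choose (w - 1))"
    using times_binomial_minus1_eq[of w n] w(1) by simp
  \<comment> \<open>This rules out the degenerate one-string cycle.\<close>
  have "n choose w \<ge> 2"
  proof (rule ccontr)
    assume "\<not> n choose w \<ge> 2"
    then have "n choose w = 1"
      using zero_less_binomial[of w n] assms(2) by linarith
    then have "n dvd w"
      using absorb by (metis dvd_triv_left mult.right_neutral)
    then show False
      using assms(2) w(1) by (auto dest: dvd_imp_le)
  qed
  then have "n dvd n choose w"
    using dvd_length_cyclic_gray_code[OF G(1)] G(2) by simp
  then obtain q where "n choose w = n * q" ..
  \<comment> \<open>Substitute into \<open>absorb\<close> and cancel the factor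
    \<open>n\<close>.\<close>
  then have "w * q = (n - 1) choose (w - 1)"
    using absorb assms(2) by simp
  then have "w dvd ((n - 1) choose (w - 1))"
    by (metis dvd_triv_left)
  then show False
    using prime_not_dvd_pred_choose[OF assms(1) w(2), of "w - 1"] assms(2) w(1) by simp
qed

end
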